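(* Let $E_1,E_2,\ldots$ be sequential e-values for $H_1,H_2,\ldots$. Let $S_1\subseteq S_2\subseteq\cdots$ be the query sets and $d_1\le d_2\le\cdots$ the bounds produced by the \texttt{SeqE-Guard} algorithm. Then the bounds $d_t$ are the same as those obtained by the online closure principle with the intersection tests $$\phi_I=\mathbb{1}\Big\{\exists t\in I:\ \prod_{i\in I\cap\{1,\ldots,t\}}E_i\ge 1/\alpha\Big\}\qquad (I\subseteq\mathbb{N}),$$ i.e. $d_t=\boldsymbol{d}^{\boldsymbol{\phi}}(S_t)$ for all $t\in\mathbb{N}$. In particular, for all $\mathbb{P}\in\mathcal{P}$, $$\mathbb{P}\big(d_t\le |S_t\cap I_1^{\mathbb{P}}|\ \text{ for all } t\in\mathbb{N}\big)\ge 1-\alpha.$$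
   Context: Setting. $\mathbb{N}=\{1,2,\ldots\}$, $\alpha\in(0,1)$ is fixed, $\Omega$ is equipped with a filtration $(\mathcal{F}_i)_{i\in\mathbb{N}_0}$ with $\mathcal{F}_0=\{\emptyset,\Omega\}$, and $\mathcal{P}$ is a set of probability distributions. Null hypotheses are subsets $H_1,H_2,\ldots\subseteq\mathcal{P}$. For $\mathbb{P}\in\mathcal{P}$: $I_0^{\mathbb{P}}=\{i\in\mathbb{N}:\mathbb{P}\in H_i\}$, $I_1^{\mathbb{P}}=\mathbb{N}\setminus I_0^{\mathbb{P}}$. Sequential e-values for $H_1,H_2,\ldots$: nonnegative random variables $E_1,E_2,\ldots$ such that $E_t$ is $\mathcal{F}_t$-measurable and $\mathbb{E}_{\mathbb{P}}[E_t\mid\mathcal{F}_{t-1}]\le 1$ for all $\mathbb{P}\in H_t$, $t\in\mathbb{N}$. Closed procedure: $\boldsymbol{d}^{\boldsymbol{\phi}}(S)=\inf\{|S\setminus I|: I\subseteq\mathbb{N},\ \phi_I=0\}$ for finite $S\subseteq\mathbb{N}$. \texttt{SeqE-Guard} algorithm. Input: $E_1,E_2,\ldots$. Initialize $d_0=0$, $S_0=\emptyset$, $U=\emptyset$, $A=\emptyset$. For $t=1,2,\ldots$: set $d_t=d_{t-1}$; the statistician decides, (measurably) based on $E_1,\ldots,E_t$ and otherwise arbitrarily, whether $S_t=S_{t-1}\cup\{t\}$ or $S_t=S_{t-1}$. If $t\in S_t$: replace $A$ by $A\cup\{t\}$; then, if $\prod_{i\in A\cup U}E_i\ge 1/\alpha$,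 set $d_t=d_{t-1}+1$ and remove from $A$ the index of a largest e-value in $A$ (ties broken arbitrarily). If instead $t\notin S_t$ and $E_t<1$: replace $U$ by $U\cup\{t\}$. Output $(S_t,d_t)$. *)

theory Defs
  imports "HOL-Probability.Probability"
begin

text \<open>
  Conventions. Hypotheses and e-values are indexed by \<open>{1, 2, \<dots>}\<close>, written as \<open>{1..}\<close> below; the values at
  index 0 of \<open>E\<close> and \<open>H\<close> are never used. \<open>M\<close> supplies only the measurable space (\<open>\<Omega>\<close> and the
  ambient sigma-algebra); the distributions are the measures in the set \<open>PP\<close>. Likewise, only
  the sigma-algebra of each \<open>F t\<close> matters.
\<close>

definition filtered_model :: "'a measure \<Rightarrow> (nat \<Rightarrow> 'a measure) \<Rightarrow> 'a measure set \<Rightarrow> bool" where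
  "filtered_model M F PP \<longleftrightarrow>
     filtration (space M) F \<and>
     (\<forall>t. subalgebra M (F t)) \<and>
     sets (F 0) = {{}, space M} \<and>
     (\<forall>P\<in>PP. prob_space P \<and> sets P = sets M)"

definition true_nulls :: "(nat \<Rightarrow> 'a measure set) \<Rightarrow> 'a measure \<Rightarrow> nat set" where
  "true_nulls H P = {i \<in> {1..}. P \<in> H i}"

definition false_nulls :: "(nat \<Rightarrow> 'a measure set) \<Rightarrow> 'a measure \<Rightarrow> nat set" where
  "false_nulls H P = {1..} - true_nulls H P"

text \<open>
  The conditional expectation is the \<open>ennreal\<close>-valued one: it needs no integrability assumption,
  whereas \<open>real_cond_exp\<close> would turn an infinite conditional expectation into 0.
\<close>

definition sequential_e_values ::
  "'a measure \<Rightarrow> (nat \<Rightarrow> 'a measure) \<Rightarrow> (nat \<Rightarrow> 'a measure set) \<Rightarrow> (nat \<Rightarrow> 'a \<Rightarrow> real) \<Rightarrow> bool"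
where
  "sequential_e_values M F H E \<longleftrightarrow>
     (\<forall>t\<ge>1. (\<forall>\<omega>\<in>space M. 0 \<le> E t \<omega>) \<and>
        E t \<in> borel_measurable (F t) \<and>
        (\<forall>P\<in>H t. AE \<omega> in P. nn_cond_exp P (F (t - 1)) (\<lambda>\<omega>. ennreal (E t \<omega>)) \<omega> \<le> 1))"

definition intersection_test :: "real \<Rightarrow> (nat \<Rightarrow> real) \<Rightarrow> nat set \<Rightarrow> nat" where
  "intersection_test \<alpha> e I = of_bool (\<exists>t\<in>I. (\<Prod>i\<in>I \<inter> {1..t}. e i) \<ge> 1 / \<alpha>)"

text \<open>
  The value lies in \<open>enat\<close>, so that the infimum over an empty family is infinity; \<open>S\<close> is meant to
  be finite.
\<close>

definition closed_procedure :: "(nat set \<Rightarrow> nat) \<Rightarrow> nat set \<Rightarrow> enat" where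
  "closed_procedure \<phi> S = (INF I\<in>{I. I \<subseteq> {1..} \<and> \<phi> I = 0}. enat (card (S - I)))"

record guard_state =
  query :: "nat set"
  bound :: nat
  active :: "nat set"
  unqueried :: "nat set"

text \<open>
  One iteration of \<open>SeqE-Guard\<close> at time \<open>t\<close> on a fixed realisation \<open>e\<close> of the e-values. It is a
  relation rather than a function because both the querying decision and the tie-breaking among
  the largest e-values are left open.
\<close>

inductive guard_step ::
  "real \<Rightarrow> (nat \<Rightarrow> real) \<Rightarrow> nat \<Rightarrow> guard_state \<Rightarrow> guard_state \<Rightarrow> bool"
  for \<alpha> :: real and e :: "nat \<Rightarrow> real" and t :: nat
where
  query_keep:
    "\<not> (\<Prod>i\<in>insert t A \<union> U. e i) \<ge> 1 / \<alpha> \<Longrightarrow>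
     guard_step \<alpha> e t
       \<lparr>query = S, bound = d, active = A, unqueried = U\<rparr>
       \<lparr>query = insert t S, bound = d, active = insert t A, unqueried = U\<rparr>"
| query_remove:
    "(\<Prod>i\<in>insert t A \<union> U. e i) \<ge> 1 / \<alpha> \<Longrightarrow>
     j \<in> insert t A \<Longrightarrow> \<forall>i\<in>insert t A. e i \<le> e j \<Longrightarrow>
     guard_step \<alpha> e t
       \<lparr>query = S, bound = d, active = A, unqueried = U\<rparr>
       \<lparr>query = insert t S, bound = d + 1, active = insert t A - {j}, unqueried = U\<rparr>"
| skip_small:
    "e t < 1 \<Longrightarrow>
     guard_step \<alpha> e t
       \<lparr>query = S, bound = d, active = A, unqueried = U\<rparr>
       \<lparr>query = S, bound = d, active = A, unqueried = insert t U\<rparr>"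
| skip_large:
    "\<not> e t < 1 \<Longrightarrow>
     guard_step \<alpha> e t
       \<lparr>query = S, bound = d, active = A, unqueried = U\<rparr>
       \<lparr>query = S, bound = d, active = A, unqueried = U\<rparr>"

definition guard_run ::
  "real \<Rightarrow> (nat \<Rightarrow> real) \<Rightarrow> (nat \<Rightarrow> nat set) \<Rightarrow> (nat \<Rightarrow> nat) \<Rightarrow> bool"
where
  "guard_run \<alpha> e S d \<longleftrightarrow>
     (\<exists>\<sigma>. \<sigma> 0 = \<lparr>query = {}, bound = 0, active = {}, unqueried = {}\<rparr> \<and>
          (\<forall>t\<ge>1. guard_step \<alpha> e t (\<sigma> (t - 1)) (\<sigma> t)) \<and>
          (\<forall>t. S t = query (\<sigma> t) \<and> d t = bound (\<sigma> t)))"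

definition observed :: "'a measure \<Rightarrow> (nat \<Rightarrow> 'a \<Rightarrow> real) \<Rightarrow> nat \<Rightarrow> 'a measure" where
  "observed M E t = sigma (space M) {E i -` B \<inter> space M | i B. i \<in> {1..t} \<and> B \<in> sets borel}"

text \<open>
  The statistician's decision at time \<open>t\<close> is the event \<open>t \<in> S t \<omega>\<close>; it may depend measurably, and
  otherwise arbitrarily, on \<open>E 1, \<dots>, E t\<close>. No measurability is imposed on the tie-breaking.
\<close>

definition SeqE_Guard ::
  "'a measure \<Rightarrow> real \<Rightarrow> (nat \<Rightarrow> 'a \<Rightarrow> real) \<Rightarrow> (nat \<Rightarrow> 'a \<Rightarrow> nat set) \<Rightarrow> (nat \<Rightarrow> 'a \<Rightarrow> nat) \<Rightarrow> bool"
where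
  "SeqE_Guard M \<alpha> E S d \<longleftrightarrow>
     (\<forall>t\<ge>1. Measurable.pred (observed M E t) (\<lambda>\<omega>. t \<in> S t \<omega>)) \<and>
     (\<forall>\<omega>\<in>space M. guard_run \<alpha> (\<lambda>i. E i \<omega>) (\<lambda>t. S t \<omega>) (\<lambda>t. d t \<omega>))"

end

theory Submission
  imports Defs
begin

text \<open>
  The set \<open>I = A \<union> U\<close> kept by the algorithm passes its own intersection test: whenever the product
  would reach \<open>1 / \<alpha>\<close>, the removed maximum exceeds 1, so neither the current nor any earlier
  partial product grows by the removal. Hence the closed procedure is at most \<open>card (S - A) = d\<close>.
  Conversely, by a greedy exchange argument every \<open>I\<close> that is not rejected admits an injection
  \<open>f : I \<inter> S \<rightarrow> A\<close> with \<open>e (f i) \<le> e i\<close>, so \<open>card (S - I) \<ge> d\<close>. The coverage guarantee is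
  Ville's inequality for the supermartingale of running products over the true nulls; the closed
  form of \<open>d\<close> also makes the event measurable although the tie-breaking need not be.
\<close>

section \<open>Loop invariant and injective domination of index sets\<close>

text \<open>The last conjunct ranges over all prefixes because the intersection test does: it says
  that \<open>A \<union> U\<close> is not rejected. Together with \<open>A \<subseteq> S\<close>,
  the cardinality equation encodes \<open>d = card (S - A)\<close>. Indices outside \<open>S\<close>
  and \<open>U\<close> carry factors of at least 1, which matters when they are dropped from a
  product.\<close>

definition guard_inv :: "real \<Rightarrow> (nat \<Rightarrow> real) \<Rightarrow> nat \<Rightarrow> guard_state \<Rightarrow> bool" where
  "guard_inv \<alpha> e t st \<longleftrightarrow>
     query st \<subseteq> {1..t} \<and> active st \<subseteq> query st \<and> unqueried st \<subseteq> {1..t} - query st \<and>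
     (\<forall>i\<in>unqueried st. e i < 1) \<and> (\<forall>i\<in>{1..t} - query st - unqueried st. 1 \<le> e i) \<and>
     card (query st) = card (active st) + bound st \<and>
     (\<forall>s. prod e ((active st \<union> unqueried st) \<inter> {1..s}) < 1 / \<alpha>)"

text \<open>A strengthening of \<open>card B \<le> card A\<close> that can be carried through the
  run: with the e-values compared along the injection, a gap between the products reveals an
  unmatched element of \<open>A\<close>.\<close>

definition dominates :: "(nat \<Rightarrow> real) \<Rightarrow> nat set \<Rightarrow> nat set \<Rightarrow> bool" where
  "dominates e B A \<longleftrightarrow> (\<exists>f. inj_on f B \<and> f ` B \<subseteq> A \<and> (\<forall>i\<in>B. e (f i) \<le> e i))"

lemma dominates_mono: "dominates e B A \<Longrightarrow> A \<subseteq> A' \<Longrightarrow> dominates e B A'"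
  unfolding dominates_def by blast

lemma dominates_insert:
  assumes "dominates e B A" "x \<notin> A"
  shows "dominates e (insert x B) (insert x A)"
proof -
  obtain f where f: "inj_on f B" "f ` B \<subseteq> A" "\<forall>i\<in>B. e (f i) \<le> e i"
    using assms(1) unfolding dominates_def by blast
  have "inj_on (f(x := x)) (insert x B)"
    using f assms(2) by (auto simp: inj_on_def)
  moreover have "(f(x := x)) ` insert x B \<subseteq> insert x A"
    using f by auto
  moreover have "\<forall>i\<in>insert x B. e ((f(x := x)) i) \<le> e i"
    using f by auto
  ultimately show ?thesis unfolding dominates_def by blast
qed

lemma dominates_card_le: "dominates e B A \<Longrightarrow> finite A \<Longrightarrow> card B \<le> card A"
  unfolding dominates_def by (meson card_inj_on_le)

text \<open>If \<open>j\<close> is hit by the injection, its preimage is redirected to an element that is missed; when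
  none is missed, the injection is a bijection and the products compare.\<close>

lemma dominates_remove_max:
  assumes dom: "dominates e B A" and "finite A"
    and max: "\<And>i. i \<in> A \<Longrightarrow> e i \<le> e j"
    and nonneg: "\<And>i. i \<in> A \<Longrightarrow> 0 \<le> e i"
    and less: "prod e B < prod e A"
  shows "dominates e B (A - {j})"
proof -
  obtain f where f: "inj_on f B" "f ` B \<subseteq> A" "\<And>i. i \<in> B \<Longrightarrow> e (f i) \<le> e i"
    using dom unfolding dominates_def by blast
  have "f ` B \<noteq> A"
  proof
    assume "f ` B = A"
    then have "prod e A = (\<Prod>i\<in>B. e (f i))"
      using prod.reindex[OF f(1), of e] by simp
    also have "\<dots> \<le> prod e B"
      using f nonneg by (intro prod_mono) blast
    finally show False using less by simp
  qed
  then obtain k where k: "k \<in> A" "k \<notin> f ` B" using f(2) by blast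
  let ?g = "\<lambda>i. if f i = j then k else f i"
  have "inj_on ?g B"
    using f(1) k(2) unfolding inj_on_def by auto
  moreover have "?g ` B \<subseteq> A - {j}"
    using f(2) k by auto
  moreover have "e (?g i) \<le> e i" if "i \<in> B" for i
    \<comment> \<open>For a redirected \<open>i\<close>, maximality gives
      \<open>e k \<le> e j = e (f i) \<le> e i\<close>.\<close>
    using f(3)[OF that] max[OF k(1)] by auto
  ultimately show ?thesis unfolding dominates_def by blast
qed

text \<open>Membership of \<open>j\<close> in \<open>X\<close> is left open because \<open>X\<close>
  will be a prefix of \<open>A \<union> U\<close>, which may end before \<open>j\<close>.\<close>

lemma prod_remove_le:
  fixes e :: "nat \<Rightarrow> real"
  assumes "finite X" "\<And>i. i \<in> X \<Longrightarrow> 0 \<le> e i" "1 \<le> e j"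
  shows "prod e (X - {j}) \<le> prod e X"
proof (cases "j \<in> X")
  case True
  then have "prod e X = e j * prod e (X - {j})"
    using assms(1) by (simp add: prod.remove)
  moreover have "0 \<le> prod e (X - {j})" using assms(2) by (intro prod_nonneg) auto
  ultimately show ?thesis using assms(3) mult_right_mono[of 1 "e j"] by simp
qed simp

text \<open>Prefix products change only at elements of \<open>I\<close>, so testing at those times
  is testing at all times; before the first element the empty product 1 lies below
  \<open>1 / \<alpha>\<close>.\<close>

lemma intersection_test_eq_0_iff:
  assumes "0 < \<alpha>" "\<alpha> < 1" "I \<subseteq> {1..}"
  shows "intersection_test \<alpha> e I = 0 \<longleftrightarrow> (\<forall>s. prod e (I \<inter> {1..s}) < 1 / \<alpha>)"
proof
  assume test: "intersection_test \<alpha> e I = 0"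
  show "\<forall>s. prod e (I \<inter> {1..s}) < 1 / \<alpha>"
  proof
    fix s
    show "prod e (I \<inter> {1..s}) < 1 / \<alpha>"
    proof (cases "I \<inter> {1..s} = {}")
      case True
      then show ?thesis using assms by simp
    next
      case False
      let ?m = "Max (I \<inter> {1..s})"
      have m: "?m \<in> I \<inter> {1..s}" using False by (intro Max_in) auto
      have "I \<inter> {1..?m} = I \<inter> {1..s}" using m by (auto intro!: Max_ge)
      moreover have "prod e (I \<inter> {1..?m}) < 1 / \<alpha>"
        using test m by (auto simp: intersection_test_def not_le)
      ultimately show ?thesis by simp
    qed
  qed
next
  assume "\<forall>s. prod e (I \<inter> {1..s}) < 1 / \<alpha>"
  then show "intersection_test \<alpha> e I = 0"
    by (auto simp: intersection_test_def not_le)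
qed

section \<open>The set kept by the algorithm is never rejected\<close>

lemma guard_inv_finite:
  assumes "guard_inv \<alpha> e t st"
  shows "finite (query st)" "finite (active st)" "finite (unqueried st)"
  using assms unfolding guard_inv_def by (meson Diff_subset finite_atLeastAtMost finite_subset)+

lemma guard_inv_init:
  assumes "0 < \<alpha>" "\<alpha> < 1"
  shows "guard_inv \<alpha> e 0 \<lparr>query = {}, bound = 0, active = {}, unqueried = {}\<rparr>"
  using assms by (simp add: guard_inv_def)

text \<open>Prefixes with \<open>s \<le> t\<close> are unchanged or lose a factor
  \<open>e j > 1\<close>. Prefixes with \<open>s > t\<close> contain the whole index set, so each
  branch that changes the state has one full product to bound.\<close>

lemma guard_inv_step:
  assumes nonneg: "\<And>i. i \<ge> 1 \<Longrightarrow> 0 \<le> e i"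
    and step: "guard_step \<alpha> e (Suc t) st st'"
    and inv: "guard_inv \<alpha> e t st"
  shows "guard_inv \<alpha> e (Suc t) st'"
  using step
proof cases
  case (query_keep A U S d)
  have fin: "finite A" "finite U" "finite S"
    using guard_inv_finite[OF inv] query_keep by auto
  have sub: "S \<subseteq> {1..t}" "A \<subseteq> S" "U \<subseteq> {1..t} - S" "card S = card A + d"
    and pre: "\<And>s. prod e ((A \<union> U) \<inter> {1..s}) < 1 / \<alpha>"
    using inv query_keep by (auto simp: guard_inv_def)
  have "prod e ((insert (Suc t) A \<union> U) \<inter> {1..s}) < 1 / \<alpha>" for s
  proof (cases "s \<le> t")
    case True
    then have "(insert (Suc t) A \<union> U) \<inter> {1..s} = (A \<union> U) \<inter> {1..s}" by auto
    then show ?thesis using pre by simp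
  next
    case False
    then have "(insert (Suc t) A \<union> U) \<inter> {1..s} = insert (Suc t) A \<union> U" using sub by force
    then show ?thesis using query_keep by simp
  qed
  moreover have "card (insert (Suc t) S) = card (insert (Suc t) A) + d"
  proof -
    have "Suc t \<notin> S" "Suc t \<notin> A" using sub by auto
    then show ?thesis using fin sub by simp
  qed
  moreover have "{1..Suc t} - insert (Suc t) S - U = {1..t} - S - U" by auto
  moreover have "insert (Suc t) S \<subseteq> {1..Suc t}" "insert (Suc t) A \<subseteq> insert (Suc t) S"
    "U \<subseteq> {1..Suc t} - insert (Suc t) S" using sub by auto
  ultimately show ?thesis
    using inv unfolding query_keep guard_inv_def by simp
next
  case (query_remove A U j S d)
  have fin: "finite A" "finite U" "finite S"
    using guard_inv_finite[OF inv] query_remove by auto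
  have sub: "S \<subseteq> {1..t}" "A \<subseteq> S" "U \<subseteq> {1..t} - S" "card S = card A + d"
    and pre: "\<And>s. prod e ((A \<union> U) \<inter> {1..s}) < 1 / \<alpha>"
    using inv query_remove by (auto simp: guard_inv_def)
  have new: "Suc t \<notin> S" "Suc t \<notin> A" "Suc t \<notin> U" using sub by auto
  have "(A \<union> U) \<inter> {1..t} = A \<union> U" using sub by auto
  then have AU: "prod e (A \<union> U) < 1 / \<alpha>" using pre[of t] by simp
  have AU0: "0 \<le> prod e (A \<union> U)" using sub nonneg by (intro prod_nonneg) auto
  have prod_eq: "prod e (insert (Suc t) A \<union> U) = e (Suc t) * prod e (A \<union> U)"
    using new fin by simp
  \<comment> \<open>The product was below \<open>1 / \<alpha>\<close> before the factor
    \<open>e (Suc t)\<close> and is not below it afterwards.\<close>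
  have et: "1 < e (Suc t)"
  proof (rule ccontr)
    assume "\<not> 1 < e (Suc t)"
    then have "e (Suc t) * prod e (A \<union> U) \<le> prod e (A \<union> U)"
      using AU0 mult_right_mono[of "e (Suc t)" 1] by simp
    then show False using AU prod_eq query_remove by simp
  qed
  then have ej: "e (Suc t) \<le> e j" "1 < e j" using query_remove by auto
  have jU: "j \<notin> U" using query_remove sub by auto
  have "prod e ((insert (Suc t) A - {j} \<union> U) \<inter> {1..s}) < 1 / \<alpha>" for s
  proof (cases "s \<le> t")
    case True
    then have "(insert (Suc t) A - {j} \<union> U) \<inter> {1..s} = (A \<union> U) \<inter> {1..s} - {j}"
      using jU by auto
    moreover have "prod e ((A \<union> U) \<inter> {1..s} - {j}) \<le> prod e ((A \<union> U) \<inter> {1..s})"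
      using ej nonneg by (intro prod_remove_le) auto
    ultimately show ?thesis using pre[of s] by simp
  next
    case False
    then have "insert (Suc t) (A \<union> U) \<subseteq> {1..s}" using sub by auto
    then have eq: "(insert (Suc t) A - {j} \<union> U) \<inter> {1..s} = insert (Suc t) (A \<union> U) - {j}"
      using jU by blast
    \<comment> \<open>Adding \<open>Suc t\<close> and removing \<open>j\<close> changes the product
      over \<open>A \<union> U\<close> by the ratio of \<open>e (Suc t)\<close> to
      \<open>e j\<close>, which is at most 1. The factor \<open>e j\<close> is kept on both sides to
      avoid a division.\<close>
    have "e j * prod e (insert (Suc t) (A \<union> U) - {j}) = prod e (insert (Suc t) (A \<union> U))"
    proof -
      have "finite (insert (Suc t) (A \<union> U))" "j \<in> insert (Suc t) (A \<union> U)"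
        using query_remove fin by auto
      then show ?thesis by (rule prod.remove[symmetric])
    qed
    also have "\<dots> \<le> e j * prod e (A \<union> U)"
      using new fin ej AU0 mult_right_mono by simp
    finally have "prod e (insert (Suc t) (A \<union> U) - {j}) \<le> prod e (A \<union> U)"
      using ej by simp
    then show ?thesis using AU eq by simp
  qed
  moreover have "card (insert (Suc t) S) = card (insert (Suc t) A - {j}) + (d + 1)"
    using new fin sub query_remove by simp
  moreover have "{1..Suc t} - insert (Suc t) S - U = {1..t} - S - U" by auto
  moreover have "insert (Suc t) S \<subseteq> {1..Suc t}" "insert (Suc t) A - {j} \<subseteq> insert (Suc t) S"
    "U \<subseteq> {1..Suc t} - insert (Suc t) S" using sub by auto
  ultimately show ?thesis
    using inv unfolding query_remove guard_inv_def by simp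
next
  case (skip_small S d A U)
  have fin: "finite A" "finite U" "finite S"
    using guard_inv_finite[OF inv] skip_small by auto
  have sub: "S \<subseteq> {1..t}" "A \<subseteq> S" "U \<subseteq> {1..t} - S"
    and pre: "\<And>s. prod e ((A \<union> U) \<inter> {1..s}) < 1 / \<alpha>"
    using inv skip_small by (auto simp: guard_inv_def)
  have "prod e ((A \<union> insert (Suc t) U) \<inter> {1..s}) < 1 / \<alpha>" for s
  proof (cases "s \<le> t")
    case True
    then have "(A \<union> insert (Suc t) U) \<inter> {1..s} = (A \<union> U) \<inter> {1..s}" by auto
    then show ?thesis using pre by simp
  next
    case False
    then have eq: "(A \<union> insert (Suc t) U) \<inter> {1..s} = insert (Suc t) (A \<union> U)"
        "(A \<union> U) \<inter> {1..s} = A \<union> U" using sub by force+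
    have "0 \<le> prod e (A \<union> U)" using sub nonneg by (intro prod_nonneg) auto
    then have "e (Suc t) * prod e (A \<union> U) \<le> prod e (A \<union> U)"
      using skip_small mult_right_mono[of "e (Suc t)" 1] by simp
    moreover have "prod e (insert (Suc t) (A \<union> U)) = e (Suc t) * prod e (A \<union> U)"
      using sub fin by (intro prod.insert) auto
    ultimately show ?thesis using pre[of s] eq by simp
  qed
  moreover have "{1..Suc t} - S - insert (Suc t) U = {1..t} - S - U" by auto
  moreover have "S \<subseteq> {1..Suc t}" "insert (Suc t) U \<subseteq> {1..Suc t} - S" using sub by auto
  ultimately show ?thesis
    using inv skip_small(3) unfolding skip_small(1,2) guard_inv_def by simp
next
  case (skip_large S d A U)
  \<comment> \<open>The state stays the same, and \<open>Suc t\<close> joins the indices outside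
    \<open>S\<close> and \<open>U\<close>, where the branch condition supplies
    \<open>1 \<le> e (Suc t)\<close>.\<close>
  then show ?thesis
    using inv unfolding guard_inv_def by (auto simp: le_Suc_eq)
qed

section \<open>Exchange argument against an arbitrary non-rejected set\<close>

text \<open>Passing from \<open>I \<inter> {1..t}\<close> to
  \<open>(I \<inter> S) \<union> U\<close> inserts factors of at most 1 (those of
  \<open>U - I\<close>) and drops factors of at least 1 (the skipped large e-values in
  \<open>I\<close>). Hence the product does not increase, and \<open>I\<close> can be compared with
  the algorithm on the queried indices alone.\<close>

lemma prod_query_unqueried_less:
  assumes nonneg: "\<And>i. i \<ge> 1 \<Longrightarrow> 0 \<le> e i"
    and inv: "guard_inv \<alpha> e t st"
    and less: "prod e (I \<inter> {1..t}) < 1 / \<alpha>"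
  shows "prod e (I \<inter> query st) * prod e (unqueried st) < 1 / \<alpha>"
proof -
  let ?S = "query st" and ?U = "unqueried st"
  let ?L = "{1..t} - ?S - ?U"
  have sub: "?S \<subseteq> {1..t}" "?U \<subseteq> {1..t} - ?S"
    and small: "\<And>i. i \<in> ?U \<Longrightarrow> e i < 1" and large: "\<And>i. i \<in> ?L \<Longrightarrow> 1 \<le> e i"
    using inv by (auto simp: guard_inv_def)
  have fin: "finite ?S" "finite ?U"
    using guard_inv_finite[OF inv] by auto
  have "0 \<le> e i \<and> e i \<le> 1" if "i \<in> ?U - I" for i
  proof -
    have "i \<in> ?U" "1 \<le> i" using that sub by auto
    then show ?thesis using small[of i] nonneg[of i] by simp
  qed
  then have "prod e (?U - I) \<le> 1" by (intro prod_le_1) blast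
  moreover have "1 \<le> prod e (I \<inter> ?L)" using large by (intro prod_ge_1) auto
  ultimately have UL: "prod e (?U - I) \<le> prod e (I \<inter> ?L)" by simp
  have "prod e ?U = prod e (I \<inter> ?U) * prod e (?U - I)"
    using fin prod.Int_Diff[of ?U e I] by (simp add: Int_commute)
  then have "prod e (I \<inter> ?S) * prod e ?U = prod e (I \<inter> ?S) * prod e (I \<inter> ?U) * prod e (?U - I)"
    by simp
  also have "\<dots> \<le> prod e (I \<inter> ?S) * prod e (I \<inter> ?U) * prod e (I \<inter> ?L)"
  proof (rule mult_left_mono[OF UL])
    have "?S \<subseteq> {1..}" "?U \<subseteq> {1..}" using sub by auto
    then show "0 \<le> prod e (I \<inter> ?S) * prod e (I \<inter> ?U)"
      using nonneg by (intro mult_nonneg_nonneg prod_nonneg) blast+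
  qed
  also have "\<dots> = prod e ((I \<inter> ?S) \<union> (I \<inter> ?U) \<union> (I \<inter> ?L))"
  proof -
    have "prod e (I \<inter> ?S \<union> I \<inter> ?U) = prod e (I \<inter> ?S) * prod e (I \<inter> ?U)"
      using fin sub by (intro prod.union_disjoint) auto
    moreover have "prod e ((I \<inter> ?S \<union> I \<inter> ?U) \<union> I \<inter> ?L) = prod e (I \<inter> ?S \<union> I \<inter> ?U) * prod e (I \<inter> ?L)"
      using fin by (intro prod.union_disjoint) auto
    ultimately show ?thesis by simp
  qed
  also have "(I \<inter> ?S) \<union> (I \<inter> ?U) \<union> (I \<inter> ?L) = I \<inter> {1..t}" using sub by auto
  finally show ?thesis using less by simp
qed

text \<open>Only a removal can endanger the injection. There the algorithm's product has reached
  \<open>1 / \<alpha>\<close> while the one belonging to \<open>I\<close> has not; both contain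
  \<open>prod e U\<close>, and cancelling it yields the strict inequality under which the maximum
  may be discarded.\<close>

lemma dominates_step:
  assumes nonneg: "\<And>i. i \<ge> 1 \<Longrightarrow> 0 \<le> e i"
    and step: "guard_step \<alpha> e (Suc t) st st'"
    and inv: "guard_inv \<alpha> e t st"
    and less: "prod e (I \<inter> {1..Suc t}) < 1 / \<alpha>"
    and dom: "dominates e (I \<inter> query st) (active st)"
  shows "dominates e (I \<inter> query st') (active st')"
proof -
  have sub: "query st \<subseteq> {1..t}" "active st \<subseteq> query st" "unqueried st \<subseteq> {1..t} - query st"
    using inv by (auto simp: guard_inv_def)
  have fin: "finite (active st)" "finite (unqueried st)"
    using guard_inv_finite[OF inv] by auto
  \<comment> \<open>Shared by both query branches: \<open>Suc t\<close> is matched to itself if it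
    lies in \<open>I\<close>; otherwise only the target set grows.\<close>
  have dom': "dominates e (I \<inter> insert (Suc t) (query st)) (insert (Suc t) (active st))"
  proof (cases "Suc t \<in> I")
    case True
    moreover have "Suc t \<notin> active st" using sub by auto
    ultimately show ?thesis using dominates_insert[OF dom] by simp
  next
    case False
    then show ?thesis using dominates_mono[OF dom] by auto
  qed
  from step show ?thesis
  proof cases
    case (query_keep A U S d)
    then show ?thesis using dom' by simp
  next
    case (query_remove A U j S d)
    \<comment> \<open>The product bound is needed after the step, when \<open>Suc t\<close> already
      counts as queried.\<close>
    have inv': "guard_inv \<alpha> e (Suc t) st'" using guard_inv_step[OF nonneg step inv] .
    have "prod e (I \<inter> insert (Suc t) S) * prod e U < 1 / \<alpha>"
      using prod_query_unqueried_less[OF nonneg inv' less] query_remove by simp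
    also have "\<dots> \<le> prod e (insert (Suc t) A \<union> U)" using query_remove by simp
    also have "\<dots> = prod e (insert (Suc t) A) * prod e U"
      using query_remove sub fin by (intro prod.union_disjoint) auto
    \<comment> \<open>A strict inequality permits cancelling a factor known only to be nonnegative,
      so e-values equal to 0 do no harm.\<close>
    finally have "prod e (I \<inter> insert (Suc t) S) < prod e (insert (Suc t) A)"
      using query_remove sub nonneg
      by (elim mult_right_less_imp_less) (auto intro!: prod_nonneg)
    then have "dominates e (I \<inter> insert (Suc t) S) (insert (Suc t) A - {j})"
      using dom' query_remove fin nonneg sub by (intro dominates_remove_max) auto
    then show ?thesis using query_remove by simp
  qed (use dom in auto)
qed

section \<open>Closed form of the bounds and of the query sets\<close>

text \<open>The minimiser is \<open>A \<union> U\<close>. That it lies in \<open>{1..t}\<close>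
  reduces the infimum to finitely many candidates, which the measurability argument relies
  on.\<close>

lemma guard_run_closure:
  assumes \<alpha>: "0 < \<alpha>" "\<alpha> < 1"
    and nonneg: "\<And>i. i \<ge> 1 \<Longrightarrow> 0 \<le> e i"
    and run: "guard_run \<alpha> e S d"
  shows "S t \<subseteq> {1..t}"
    and "I \<subseteq> {1..} \<Longrightarrow> intersection_test \<alpha> e I = 0 \<Longrightarrow> d t \<le> card (S t - I)"
    and "\<exists>I\<subseteq>{1..t}. intersection_test \<alpha> e I = 0 \<and> card (S t - I) = d t"
proof -
  obtain \<sigma> where init: "\<sigma> 0 = \<lparr>query = {}, bound = 0, active = {}, unqueried = {}\<rparr>"
    and step: "\<And>t. guard_step \<alpha> e (Suc t) (\<sigma> t) (\<sigma> (Suc t))"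
    and out: "\<And>t. S t = query (\<sigma> t)" "\<And>t. d t = bound (\<sigma> t)"
    using run unfolding guard_run_def by (metis diff_Suc_1 le_add1 plus_1_eq_Suc)
  have inv: "guard_inv \<alpha> e t (\<sigma> t)" for t
    by (induction t) (use guard_inv_init[OF \<alpha>] init guard_inv_step[OF nonneg step] in auto)
  have sub: "S t \<subseteq> {1..t}" "active (\<sigma> t) \<subseteq> S t" "unqueried (\<sigma> t) \<subseteq> {1..t} - S t"
    and card: "card (S t) = card (active (\<sigma> t)) + d t"
    and pre: "\<And>s. prod e ((active (\<sigma> t) \<union> unqueried (\<sigma> t)) \<inter> {1..s}) < 1 / \<alpha>"
    using inv[of t] by (auto simp: guard_inv_def out)
  have fin: "finite (S t)" "finite (active (\<sigma> t))"
    using guard_inv_finite[OF inv[of t]] out by auto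
  show "S t \<subseteq> {1..t}" by (fact sub)

  {
    assume I: "I \<subseteq> {1..}" "intersection_test \<alpha> e I = 0"
    then have less: "prod e (I \<inter> {1..s}) < 1 / \<alpha>" for s
      using intersection_test_eq_0_iff[OF \<alpha>] by blast
    \<comment> \<open>The set \<open>I\<close> is fixed beforehand and passes the test at every
      time, so the domination can be propagated from the empty initial state.\<close>
    have "dominates e (I \<inter> query (\<sigma> t)) (active (\<sigma> t))" for t
    proof (induction t)
      case 0
      then show ?case by (simp add: init dominates_def)
    next
      case (Suc t)
      show ?case by (rule dominates_step[OF nonneg step inv less Suc.IH])
    qed
    then have "card (I \<inter> S t) \<le> card (active (\<sigma> t))"
      using fin out by (metis dominates_card_le)
    moreover have "card (S t - I) = card (S t) - card (I \<inter> S t)"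
      using fin by (metis Int_commute card_Diff_subset_Int finite_Int)
    ultimately show "d t \<le> card (S t - I)" using card by simp
  }

  let ?I = "active (\<sigma> t) \<union> unqueried (\<sigma> t)"
  have "?I \<subseteq> {1..t}" using sub by auto
  moreover have "intersection_test \<alpha> e ?I = 0"
  proof -
    have "?I \<subseteq> {1..}" using sub by auto
    then show ?thesis using intersection_test_eq_0_iff[OF \<alpha>] pre by blast
  qed
  \<comment> \<open>The set \<open>U\<close> is disjoint from \<open>S t\<close>, so it removes
    nothing from the count.\<close>
  moreover have "S t - ?I = S t - active (\<sigma> t)" using sub by auto
  then have "card (S t - ?I) = d t"
    using card fin sub by (simp add: card_Diff_subset)
  ultimately show "\<exists>I\<subseteq>{1..t}. intersection_test \<alpha> e I = 0 \<and> card (S t - I) = d t"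
    by blast
qed

text \<open>An index can enter only at its own time and never leaves. Thus \<open>S t\<close> is a
  function of the decisions \<open>i \<in> S i\<close>, the events whose measurability is
  assumed.\<close>

lemma guard_run_query_eq:
  assumes "guard_run \<alpha> e S d"
  shows "S t = {i \<in> {1..t}. i \<in> S i}"
proof -
  obtain \<sigma> where init: "\<sigma> 0 = \<lparr>query = {}, bound = 0, active = {}, unqueried = {}\<rparr>"
    and step: "\<And>t. guard_step \<alpha> e (Suc t) (\<sigma> t) (\<sigma> (Suc t))"
    and out: "\<And>t. S t = query (\<sigma> t)"
    using assms unfolding guard_run_def by (metis diff_Suc_1 le_add1 plus_1_eq_Suc)
  have Suc: "S (Suc t) = S t \<or> S (Suc t) = insert (Suc t) (S t)" for t
    using step[of t] by cases (auto simp: out)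
  show ?thesis
  proof (induction t)
    case 0
    then show ?case by (simp add: out init)
  next
    case (Suc t)
    then have "Suc t \<notin> S t" by auto
    then have "S (Suc t) = S t \<union> {i. i = Suc t \<and> i \<in> S i}"
      using \<open>S (Suc t) = S t \<or> S (Suc t) = insert (Suc t) (S t)\<close> by auto
    then show ?case using Suc.IH by (auto simp: le_Suc_eq)
  qed
qed

section \<open>Ville's inequality via a frozen product process\<close>

text \<open>Ville's inequality for the running product over \<open>I\<close> is Markov's inequality for this process.\<close>

primrec stopped_prod :: "real \<Rightarrow> nat set \<Rightarrow> (nat \<Rightarrow> real) \<Rightarrow> nat \<Rightarrow> real" where
  "stopped_prod c I e 0 = 1"
| "stopped_prod c I e (Suc t) =
     (if Suc t \<in> I \<and> stopped_prod c I e t < c then stopped_prod c I e t * e (Suc t)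
      else stopped_prod c I e t)"

lemma stopped_prod_nonneg: "(\<And>i. i \<in> I \<Longrightarrow> 0 \<le> e i) \<Longrightarrow> 0 \<le> stopped_prod c I e t"
  by (induction t) auto

text \<open>A value below \<open>c\<close> at time \<open>t\<close> means that the process was below
  \<open>c\<close> at all earlier times, since a reached threshold freezes it; so no factor has been
  omitted.\<close>

lemma stopped_prod_eq_prod:
  "stopped_prod c I e t < c \<Longrightarrow> stopped_prod c I e t = prod e (I \<inter> {1..t})"
proof (induction t)
  case (Suc t)
  have lt: "stopped_prod c I e t < c" using Suc.prems by (auto split: if_splits)
  have "I \<inter> {1..Suc t} = (if Suc t \<in> I then insert (Suc t) (I \<inter> {1..t}) else I \<inter> {1..t})"
    by (auto simp: le_Suc_eq)
  then show ?case using lt Suc.IH by (simp add: mult.commute)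
qed simp

text \<open>Because of the freezing, the events of having reached \<open>c\<close> increase in time,
  as continuity from below requires.\<close>

lemma stopped_prod_mono_reach:
  "c \<le> stopped_prod c I e s \<Longrightarrow> s \<le> t \<Longrightarrow> c \<le> stopped_prod c I e t"
  by (induction t rule: nat_induct) (auto simp: le_Suc_eq)

lemma stopped_prod_measurable:
  assumes F: "filtration \<Omega> F"
    and meas: "\<And>i. i \<in> I \<Longrightarrow> E i \<in> borel_measurable (F i)"
  shows "(\<lambda>\<omega>. stopped_prod c I (\<lambda>i. E i \<omega>) t) \<in> borel_measurable (F t)"
proof (induction t)
  case (Suc t)
  have [measurable]: "(\<lambda>\<omega>. stopped_prod c I (\<lambda>i. E i \<omega>) t) \<in> borel_measurable (F (Suc t))"
  proof (rule measurable_from_subalg[OF _ Suc])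
    show "subalgebra (F (Suc t)) (F t)"
      using filtration.sets_F_mono[OF F, of t "Suc t"] by (simp add: subalgebra_def filtration.space_F[OF F])
  qed
  show ?case
  proof (cases "Suc t \<in> I")
    case True
    note meas[OF this, measurable]
    show ?thesis using True by simp
  qed simp
qed simp

text \<open>The process is a nonnegative supermartingale started at 1: whether it is still running
  is decided by time \<open>t\<close>, and the next factor has conditional mean at most 1. Working
  with \<open>nn_integral\<close> avoids any integrability condition.\<close>

lemma nn_integral_stopped_prod_le:
  assumes P: "prob_space P" and F: "filtration (space P) F" and sub: "\<And>t. subalgebra P (F t)"
    and nonneg: "\<And>i \<omega>. i \<in> I \<Longrightarrow> \<omega> \<in> space P \<Longrightarrow> 0 \<le> E i \<omega>"
    and meas: "\<And>i. i \<in> I \<Longrightarrow> E i \<in> borel_measurable (F i)"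
    and cond: "\<And>i. i \<in> I \<Longrightarrow> AE \<omega> in P. nn_cond_exp P (F (i - 1)) (\<lambda>\<omega>. ennreal (E i \<omega>)) \<omega> \<le> 1"
  shows "(\<integral>\<^sup>+\<omega>. ennreal (stopped_prod c I (\<lambda>i. E i \<omega>) t) \<partial>P) \<le> 1"
proof (induction t)
  case 0
  interpret prob_space P by (fact P)
  show ?case by (simp add: emeasure_space_1)
next
  case (Suc t)
  interpret prob_space P by (fact P)
  let ?X = "\<lambda>t \<omega>. stopped_prod c I (\<lambda>i. E i \<omega>) t"
  show ?case
  proof (cases "Suc t \<in> I")
    case True
    interpret sigma_finite_subalgebra P "F t"
      using sub prob_space_axioms
      by (intro finite_measure_subalgebra_is_sigma_finite)
        (simp add: finite_measure_subalgebra_def finite_measure_subalgebra_axioms_def finite_measure_axioms)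
    have XF [measurable]: "?X t \<in> borel_measurable (F t)"
      by (rule stopped_prod_measurable[OF F meas])
    have [measurable]: "?X t \<in> borel_measurable P"
      by (rule measurable_from_subalg[OF sub XF])
    have [measurable]: "E (Suc t) \<in> borel_measurable P"
      by (rule measurable_from_subalg[OF sub meas[OF True]])
    \<comment> \<open>Running part \<open>?a\<close> and frozen part \<open>?b\<close> of the
      process; only the running part gets the new factor.\<close>
    let ?a = "\<lambda>\<omega>. if ?X t \<omega> < c then ennreal (?X t \<omega>) else 0"
    let ?b = "\<lambda>\<omega>. if ?X t \<omega> < c then 0 else ennreal (?X t \<omega>)"
    have "(\<integral>\<^sup>+\<omega>. ennreal (?X (Suc t) \<omega>) \<partial>P)
        = (\<integral>\<^sup>+\<omega>. ?a \<omega> * ennreal (E (Suc t) \<omega>) + ?b \<omega> \<partial>P)"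
      using True nonneg by (intro nn_integral_cong) (auto simp: ennreal_mult stopped_prod_nonneg)
    also have "\<dots> = (\<integral>\<^sup>+\<omega>. ?a \<omega> * ennreal (E (Suc t) \<omega>) \<partial>P) + (\<integral>\<^sup>+\<omega>. ?b \<omega> \<partial>P)"
      by (intro nn_integral_add) measurable
    also have "\<dots> \<le> (\<integral>\<^sup>+\<omega>. ?a \<omega> \<partial>P) + (\<integral>\<^sup>+\<omega>. ?b \<omega> \<partial>P)"
    proof (intro add_right_mono)
      \<comment> \<open>Since \<open>?a\<close> is measurable with respect to \<open>F t\<close>,
        the new factor may be replaced by its conditional expectation.\<close>
      have "(\<integral>\<^sup>+\<omega>. ?a \<omega> * ennreal (E (Suc t) \<omega>) \<partial>P)
          = (\<integral>\<^sup>+\<omega>. ?a \<omega> * nn_cond_exp P (F t) (\<lambda>\<omega>. ennreal (E (Suc t) \<omega>)) \<omega> \<partial>P)"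
        by (intro nn_cond_exp_intg[symmetric]) measurable
      also have "\<dots> \<le> (\<integral>\<^sup>+\<omega>. ?a \<omega> \<partial>P)"
      proof (intro nn_integral_mono_AE)
        have "AE \<omega> in P. nn_cond_exp P (F t) (\<lambda>\<omega>. ennreal (E (Suc t) \<omega>)) \<omega> \<le> 1"
          using cond[OF True] by simp
        then show "AE \<omega> in P. ?a \<omega> * nn_cond_exp P (F t) (\<lambda>\<omega>. ennreal (E (Suc t) \<omega>)) \<omega> \<le> ?a \<omega>"
          by eventually_elim (metis mult.right_neutral mult_left_mono zero_le)
      qed
      finally show "(\<integral>\<^sup>+\<omega>. ?a \<omega> * ennreal (E (Suc t) \<omega>) \<partial>P) \<le> (\<integral>\<^sup>+\<omega>. ?a \<omega> \<partial>P)" .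
    qed
    also have "(\<integral>\<^sup>+\<omega>. ?a \<omega> \<partial>P) + (\<integral>\<^sup>+\<omega>. ?b \<omega> \<partial>P) = (\<integral>\<^sup>+\<omega>. ?a \<omega> + ?b \<omega> \<partial>P)"
      by (intro nn_integral_add[symmetric]) measurable
    also have "\<dots> = (\<integral>\<^sup>+\<omega>. ennreal (?X t \<omega>) \<partial>P)" by (intro nn_integral_cong) auto
    also have "\<dots> \<le> 1" by (rule Suc.IH)
    finally show ?thesis .
  next
    case False
    then show ?thesis using Suc.IH by simp
  qed
qed

lemma ville_stopped_prod:
  assumes P: "prob_space P" and F: "filtration (space P) F" and sub: "\<And>t. subalgebra P (F t)"
    and nonneg: "\<And>i \<omega>. i \<in> I \<Longrightarrow> \<omega> \<in> space P \<Longrightarrow> 0 \<le> E i \<omega>"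
    and meas: "\<And>i. i \<in> I \<Longrightarrow> E i \<in> borel_measurable (F i)"
    and cond: "\<And>i. i \<in> I \<Longrightarrow> AE \<omega> in P. nn_cond_exp P (F (i - 1)) (\<lambda>\<omega>. ennreal (E i \<omega>)) \<omega> \<le> 1"
    and c: "0 < c"
  shows "{\<omega> \<in> space P. \<exists>t. c \<le> stopped_prod c I (\<lambda>i. E i \<omega>) t} \<in> sets P" (is "?A \<in> _")
    and "measure P {\<omega> \<in> space P. \<exists>t. c \<le> stopped_prod c I (\<lambda>i. E i \<omega>) t} \<le> 1 / c"
proof -
  interpret prob_space P by (fact P)
  let ?X = "\<lambda>t \<omega>. stopped_prod c I (\<lambda>i. E i \<omega>) t"
  have [measurable]: "?X t \<in> borel_measurable P" for t
    by (rule measurable_from_subalg[OF sub stopped_prod_measurable[OF F meas]])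
  show "?A \<in> sets P" by measurable
  let ?B = "\<lambda>t. {\<omega> \<in> space P. c \<le> ?X t \<omega>}"
  have B: "emeasure P (?B t) \<le> ennreal (1 / c)" for t
  proof -
    \<comment> \<open>Markov's inequality for the event \<open>1 \<le> k * u\<close> with
      \<open>k = 1 / c\<close>; this event is \<open>?B t\<close> because \<open>c\<close> is
      positive.\<close>
    have "emeasure P {\<omega> \<in> space P. 1 \<le> ennreal (1 / c) * ennreal (?X t \<omega>)}
        \<le> ennreal (1 / c) * (\<integral>\<^sup>+\<omega>. ennreal (?X t \<omega>) * indicator (space P) \<omega> \<partial>P)"
      by (rule nn_integral_Markov_inequality) auto
    also have "(\<integral>\<^sup>+\<omega>. ennreal (?X t \<omega>) * indicator (space P) \<omega> \<partial>P) = (\<integral>\<^sup>+\<omega>. ennreal (?X t \<omega>) \<partial>P)"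
      by (intro nn_integral_cong) simp
    also have "ennreal (1 / c) * \<dots> \<le> ennreal (1 / c) * 1"
      using nn_integral_stopped_prod_le[OF P F sub nonneg meas cond]
      by (intro mult_left_mono) auto
    also have "{\<omega> \<in> space P. 1 \<le> ennreal (1 / c) * ennreal (?X t \<omega>)} = ?B t"
      using c by (auto simp: ennreal_mult'[symmetric] field_simps)
    finally show ?thesis by simp
  qed
  have "?A = (\<Union>t. ?B t)" by auto
  also have "emeasure P \<dots> = (SUP t. emeasure P (?B t))"
    by (intro SUP_emeasure_incseq[symmetric])
      (auto simp: incseq_def intro: stopped_prod_mono_reach)
  also have "\<dots> \<le> ennreal (1 / c)" by (rule SUP_least) (rule B)
  finally have "ennreal (measure P ?A) \<le> ennreal (1 / c)" by (simp add: emeasure_eq_measure)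
  then show "measure P ?A \<le> 1 / c"
    using c by (simp add: ennreal_le_iff)
qed

section \<open>Measurability of the coverage event\<close>

lemma sets_observed_subset:
  assumes "\<And>i. i \<in> {1..t} \<Longrightarrow> E i \<in> borel_measurable M"
  shows "sets (observed M E t) \<subseteq> sets M"
proof -
  let ?G = "{E i -` B \<inter> space M | i B. i \<in> {1..t} \<and> B \<in> sets borel}"
  have "?G \<subseteq> sets M" using assms by (auto intro: measurable_sets)
  moreover have "?G \<subseteq> Pow (space M)" by auto
  ultimately show ?thesis
    unfolding observed_def by (simp add: sets.sigma_sets_subset)
qed

text \<open>With arbitrary tie-breaking, \<open>d t\<close> is not visibly measurable from its
  construction. By the closed form, \<open>d t \<le> k\<close> means that some non-rejected
  \<open>I\<close> in \<open>{1..t}\<close> has \<open>card (S t - I) \<le> k\<close>. Enumerating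
  \<open>I\<close> and the possible values \<open>T\<close> of \<open>S t\<close> gives a finite
  Boolean combination of decision and test events.\<close>

lemma guard_event_measurable:
  assumes \<alpha>: "0 < \<alpha>" "\<alpha> < 1"
    and nonneg: "\<And>i \<omega>. 1 \<le> i \<Longrightarrow> \<omega> \<in> space M \<Longrightarrow> 0 \<le> E i \<omega>"
    and meas: "\<And>i. 1 \<le> i \<Longrightarrow> E i \<in> borel_measurable M"
    and guard: "SeqE_Guard M \<alpha> E S d"
  shows "{\<omega> \<in> space M. \<forall>t\<ge>1. d t \<omega> \<le> card (S t \<omega> \<inter> N)} \<in> sets M"
proof -
  have query: "Measurable.pred M (\<lambda>\<omega>. i \<in> S i \<omega>)" if "1 \<le> i" for i
  proof -
    have "Measurable.pred (observed M E i) (\<lambda>\<omega>. i \<in> S i \<omega>)"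
      using guard that by (simp add: SeqE_Guard_def)
    moreover have "space (observed M E i) = space M" by (simp add: observed_def space_measure_of_conv)
    ultimately show ?thesis
      using sets_observed_subset[of i E M] meas by (auto simp: pred_def)
  qed
  have test: "Measurable.pred M (\<lambda>\<omega>. intersection_test \<alpha> (\<lambda>i. E i \<omega>) I = 0)" if "I \<subseteq> {1..}" for I
  proof -
    have [measurable]: "(\<lambda>\<omega>. \<Prod>i\<in>I \<inter> {1..s}. E i \<omega>) \<in> borel_measurable M" for s
      using meas by (intro borel_measurable_prod) auto
    have "Measurable.pred M (\<lambda>\<omega>. \<forall>s. (\<Prod>i\<in>I \<inter> {1..s}. E i \<omega>) < 1 / \<alpha>)" by measurable
    then show ?thesis unfolding intersection_test_eq_0_iff[OF \<alpha> that] .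
  qed
  have "Measurable.pred M (\<lambda>\<omega>. d t \<omega> \<le> card (S t \<omega> \<inter> N))" for t
  proof -
    have "d t \<omega> \<le> card (S t \<omega> \<inter> N) \<longleftrightarrow>
        (\<exists>I\<in>Pow {1..t}. \<exists>T\<in>Pow {1..t}. (\<forall>i\<in>{1..t}. i \<in> S i \<omega> \<longleftrightarrow> i \<in> T) \<and>
           intersection_test \<alpha> (\<lambda>i. E i \<omega>) I = 0 \<and> card (T - I) \<le> card (T \<inter> N))" (is "?l \<longleftrightarrow> ?r")
      if "\<omega> \<in> space M" for \<omega>
    proof -
      have run: "guard_run \<alpha> (\<lambda>i. E i \<omega>) (\<lambda>t. S t \<omega>) (\<lambda>t. d t \<omega>)"
        using guard that by (simp add: SeqE_Guard_def)
      \<comment> \<open>The condition on the decisions singles out the one \<open>T\<close> that is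
        the actual query set.\<close>
      have S: "T = S t \<omega>" if "T \<subseteq> {1..t}" "\<forall>i\<in>{1..t}. i \<in> S i \<omega> \<longleftrightarrow> i \<in> T" for T
        using guard_run_query_eq[OF run, of t] that by blast
      have S': "S t \<omega> \<subseteq> {1..t}" "\<forall>i\<in>{1..t}. i \<in> S i \<omega> \<longleftrightarrow> i \<in> S t \<omega>"
        using guard_run_query_eq[OF run, of t] by blast+
      have le: "\<And>I. I \<subseteq> {1..} \<Longrightarrow> intersection_test \<alpha> (\<lambda>i. E i \<omega>) I = 0 \<Longrightarrow> d t \<omega> \<le> card (S t \<omega> - I)"
        and ex: "\<exists>I\<subseteq>{1..t}. intersection_test \<alpha> (\<lambda>i. E i \<omega>) I = 0 \<and> card (S t \<omega> - I) = d t \<omega>"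
        using guard_run_closure[OF \<alpha> nonneg[OF _ that] run, where t = t] by auto
      show ?thesis
      proof
        assume ?l
        obtain I where I: "I \<subseteq> {1..t}" "intersection_test \<alpha> (\<lambda>i. E i \<omega>) I = 0"
            "card (S t \<omega> - I) = d t \<omega>"
          using ex by blast
        have "card (S t \<omega> - I) \<le> card (S t \<omega> \<inter> N)" using I(3) \<open>?l\<close> by simp
        then show ?r using S' I(1,2) by blast
      next
        assume ?r
        then obtain I T where I: "I \<subseteq> {1..t}" and T: "T \<subseteq> {1..t}" "\<forall>i\<in>{1..t}. i \<in> S i \<omega> \<longleftrightarrow> i \<in> T"
          and test: "intersection_test \<alpha> (\<lambda>i. E i \<omega>) I = 0" and card: "card (T - I) \<le> card (T \<inter> N)"
          by blast
        have "I \<subseteq> {1..}" using I by auto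
        then have "d t \<omega> \<le> card (S t \<omega> - I)" using test by (rule le)
        then show ?l using card S[OF T] by simp
      qed
    qed
    moreover have "Measurable.pred M (\<lambda>\<omega>. \<exists>I\<in>Pow {1..t}. \<exists>T\<in>Pow {1..t}.
         (\<forall>i\<in>{1..t}. i \<in> S i \<omega> \<longleftrightarrow> i \<in> T) \<and>
         intersection_test \<alpha> (\<lambda>i. E i \<omega>) I = 0 \<and> card (T - I) \<le> card (T \<inter> N))"
    proof (intro pred_intros_finite pred_intros_logic)
      fix I assume "I \<in> Pow {1..t}"
      then have "I \<subseteq> {1..}" by auto
      then show "Measurable.pred M (\<lambda>\<omega>. intersection_test \<alpha> (\<lambda>i. E i \<omega>) I = 0)" by (rule test)
    qed (use query in auto)
    ultimately show ?thesis by (simp cong: measurable_cong)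
  qed
  then show ?thesis by measurable
qed

section \<open>Closure identity and simultaneous coverage\<close>

theorem theorem3p1:
  fixes M :: "'a measure" and F :: "nat \<Rightarrow> 'a measure" and PP :: "'a measure set"
    and H :: "nat \<Rightarrow> 'a measure set" and E :: "nat \<Rightarrow> 'a \<Rightarrow> real" and \<alpha> :: real
    and S :: "nat \<Rightarrow> 'a \<Rightarrow> nat set" and d :: "nat \<Rightarrow> 'a \<Rightarrow> nat"
  assumes "0 < \<alpha>" and "\<alpha> < 1"
    and "filtered_model M F PP"
    and "\<And>t. t \<ge> 1 \<Longrightarrow> H t \<subseteq> PP"
    and "sequential_e_values M F H E"
    and "SeqE_Guard M \<alpha> E S d"
  shows "(\<forall>\<omega>\<in>space M. \<forall>t\<ge>1.
            enat (d t \<omega>) = closed_procedure (intersection_test \<alpha> (\<lambda>i. E i \<omega>)) (S t \<omega>))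
       \<and> (\<forall>P\<in>PP.
            measure P {\<omega> \<in> space P. \<forall>t\<ge>1. d t \<omega> \<le> card (S t \<omega> \<inter> false_nulls H P)} \<ge> 1 - \<alpha>)"
proof (intro conjI ballI allI impI)
  note \<alpha> = assms(1,2)
  have nonneg: "0 \<le> E i \<omega>" if "1 \<le> i" "\<omega> \<in> space M" for i \<omega>
    using assms(5) that by (simp add: sequential_e_values_def)
  have run: "guard_run \<alpha> (\<lambda>i. E i \<omega>) (\<lambda>t. S t \<omega>) (\<lambda>t. d t \<omega>)" if "\<omega> \<in> space M" for \<omega>
    using assms(6) that by (simp add: SeqE_Guard_def)
  have S: "S t \<omega> \<subseteq> {1..t}"
    and le: "\<And>I. I \<subseteq> {1..} \<Longrightarrow> intersection_test \<alpha> (\<lambda>i. E i \<omega>) I = 0 \<Longrightarrow> d t \<omega> \<le> card (S t \<omega> - I)"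
    and ex: "\<exists>I\<subseteq>{1..t}. intersection_test \<alpha> (\<lambda>i. E i \<omega>) I = 0 \<and> card (S t \<omega> - I) = d t \<omega>"
    if "\<omega> \<in> space M" for \<omega> t
    using guard_run_closure[OF \<alpha> nonneg[OF _ that] run[OF that], where t = t] by auto
  {
    fix \<omega> and t :: nat
    assume \<omega>: "\<omega> \<in> space M"
    obtain I where I: "I \<subseteq> {1..t}" "intersection_test \<alpha> (\<lambda>i. E i \<omega>) I = 0" "card (S t \<omega> - I) = d t \<omega>"
      using ex[OF \<omega>] by blast
    moreover have "I \<subseteq> {1..}" using I(1) by auto
    ultimately show "enat (d t \<omega>) = closed_procedure (intersection_test \<alpha> (\<lambda>i. E i \<omega>)) (S t \<omega>)"
      \<comment> \<open>The infimum is attained at \<open>I\<close>, hence it is finite and equals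
        the bound.\<close>
      unfolding closed_procedure_def using le[OF \<omega>]
      by (intro antisym INF_greatest INF_lower2[of I]) auto
  next
    fix P assume P: "P \<in> PP"
    have setsP: "sets P = sets M" and prob: "prob_space P"
      and filt: "filtration (space M) F" and subM: "\<And>t. subalgebra M (F t)"
      using assms(3) P by (auto simp: filtered_model_def)
    have spaceP: "space P = space M" using setsP by (rule sets_eq_imp_space_eq)
    interpret prob_space P by (fact prob)
    have sub: "subalgebra P (F t)" for t using subM by (simp add: subalgebra_def setsP spaceP)
    have measF: "E i \<in> borel_measurable (F i)" if "1 \<le> i" for i
      using assms(5) that by (simp add: sequential_e_values_def)
    have measM: "E i \<in> borel_measurable M" if "1 \<le> i" for i
      by (rule measurable_from_subalg[OF subM measF[OF that]])
    let ?I = "true_nulls H P"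
    have I: "?I \<subseteq> {1..}" by (auto simp: true_nulls_def)
    have cond: "AE \<omega> in P. nn_cond_exp P (F (i - 1)) (\<lambda>\<omega>. ennreal (E i \<omega>)) \<omega> \<le> 1" if "i \<in> ?I" for i
      using assms(5) that by (auto simp: sequential_e_values_def true_nulls_def)
    \<comment> \<open>The threshold \<open>1 / \<alpha>\<close> makes the bound in Ville's
      inequality equal to \<open>\<alpha>\<close>.\<close>
    let ?A = "{\<omega> \<in> space P. \<exists>t. 1 / \<alpha> \<le> stopped_prod (1 / \<alpha>) ?I (\<lambda>i. E i \<omega>) t}"
    let ?G = "{\<omega> \<in> space P. \<forall>t\<ge>1. d t \<omega> \<le> card (S t \<omega> \<inter> false_nulls H P)}"
    have A: "?A \<in> sets P" "measure P ?A \<le> 1 / (1 / \<alpha>)"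
    proof -
      have nonneg': "0 \<le> E i \<omega>" if "i \<in> ?I" "\<omega> \<in> space P" for i \<omega>
        using nonneg that I spaceP by auto
      have meas': "E i \<in> borel_measurable (F i)" if "i \<in> ?I" for i
        using measF that I by auto
      have filt': "filtration (space P) F" using filt spaceP by simp
      have pos: "0 < 1 / \<alpha>" using \<alpha> by simp
      show "?A \<in> sets P" "measure P ?A \<le> 1 / (1 / \<alpha>)"
        by (rule ville_stopped_prod[where E = E and F = F,
            OF prob filt' sub nonneg' meas' cond pos]; assumption)+
    qed
    \<comment> \<open>Essential for the lower bound, since \<open>measure\<close> assigns 0 to sets
      outside the sigma-algebra.\<close>
    have G: "?G \<in> sets P"
      unfolding setsP spaceP by (rule guard_event_measurable[OF \<alpha> nonneg measM assms(6)])
    \<comment> \<open>Off \<open>?A\<close> the process never freezes and equals the running product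
      over the true nulls. So \<open>?I\<close> is not rejected and competes in the infimum for
      every \<open>t\<close> at once.\<close>
    have "space P - ?A \<subseteq> ?G"
    proof
      fix \<omega> assume \<omega>: "\<omega> \<in> space P - ?A"
      then have "stopped_prod (1 / \<alpha>) ?I (\<lambda>i. E i \<omega>) t < 1 / \<alpha>" for t by (simp add: not_le)
      then have "prod (\<lambda>i. E i \<omega>) (?I \<inter> {1..t}) < 1 / \<alpha>" for t
        using stopped_prod_eq_prod[of "1 / \<alpha>" ?I "\<lambda>i. E i \<omega>" t] by metis
      then have "intersection_test \<alpha> (\<lambda>i. E i \<omega>) ?I = 0"
        using intersection_test_eq_0_iff[OF \<alpha> I] by blast
      then have "d t \<omega> \<le> card (S t \<omega> - ?I)" for t
        using le[OF _ I] \<omega> spaceP by blast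
      moreover have "S t \<omega> - ?I = S t \<omega> \<inter> false_nulls H P" for t
        using S[of \<omega> t] \<omega> spaceP by (auto simp: false_nulls_def)
      ultimately show "\<omega> \<in> ?G" using \<omega> by simp
    qed
    then have "measure P (space P - ?A) \<le> measure P ?G"
      using G by (rule finite_measure_mono)
    then show "1 - \<alpha> \<le> measure P ?G" using A prob_compl[OF A(1)] by simp
  }
qed

end
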